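(* Let $0<a<b<\infty$, let $M\ge1$ be an integer and $0<h<\infty$. Let $W(t)$ be a bounded nondecreasing function with at least $M+1$ points of increase for $a\le t\le b$, and let $f(x)=\int_a^be^{-xt}\,dW(t)$ for $0\le x<\infty$. Let $c_{h,\nu}$, $\nu=1,\dots,M$, be the weights defined in the context. Then $$0<f(0)-\sum_{\nu=1}^Mc_{h,\nu}\le\left(\sqrt{\tfrac{1+e^{-ah}}{1+e^{-bh}}}+1\right)^2\left(\frac{\sqrt{\frac{1+e^{-ah}}{1+e^{-bh}}}+1}{\sqrt{\frac{1+e^{-ah}}{1+e^{-bh}}}-1}\right)^{-2M}f(0)$$ $$\le\left(\sqrt{a/b}\,e^{\frac12(1-a/b)h_{a/b}}+1\right)^2\left(\frac{\sqrt{a/b}\,e^{\frac12(1-a/b)h_{a/b}}+1}{\sqrt{a/b}\,e^{\frac12(1-a/b)h_{a/b}}-1}\right)^{-2M}f(0)<(\sqrt2+1)^{-4M+2}f(0),$$ where, for $0<r<1$, $h_r$ denotes the unique solution $h\in(0,\infty)$ of $(1-r)e^{-h}+e^{-(1-r)h}-r=0$. Equality between the second and third upper-bound expressions (i.e. in the second "$\le$" above) holds if and only if $h=h_{a/b}/b$.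
   Context: Integrals $\int\cdot\,dW$ are Riemann–Stieltjes integrals. A point of increase of a nondecreasing function $W$ on $[a,b]$ is a point no neighbourhood of which (relative to $[a,b]$) has $W$ constant on it. For $e^{-bh}\le y\le e^{-ah}$ put $W_h(y)=-W(-\log(y)/h)$ and $\widehat W_h(y)=\int_{e^{-bh}}^y(1+Y)\,dW_h(Y)$. Let $e^{-bh}<y_{h,1}<\dots<y_{h,M}<e^{-ah}$ and $d_{h,\nu}>0$ be the nodes and weights of the $M$-point Gaussian quadrature for $d\widehat W_h$ on $[e^{-bh},e^{-ah}]$, i.e. $f(ih)+f((i+1)h)=\int_{e^{-bh}}^{e^{-ah}}y^i\,d\widehat W_h(y)=\sum_{\nu=1}^Md_{h,\nu}y_{h,\nu}^i$ for $i=0,\dots,2M-1$. Define $c_{h,\nu}=\dfrac{d_{h,M-\nu+1}}{1+y_{h,M-\nu+1}}$, $\nu=1,\dots,M$. *)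

theory Defs
  imports "HOL-Analysis.Analysis"
begin

text \<open>
  The integrators are monotone but not assumed one-sided continuous, so the integral is the
  classical Riemann--Stieltjes one: the limit of the tagged sums as the mesh tends to zero.
  A tagged division that is fine for balls of constant radius \<open>\<delta>\<close> has mesh below \<open>2 * \<delta>\<close>, and
  conversely mesh below \<open>\<delta>\<close> gives fineness; \<open>Inf k\<close> and \<open>Sup k\<close> are the endpoints of the cell \<open>k\<close>.
\<close>

definition has_RS_integral ::
  "(real \<Rightarrow> real) \<Rightarrow> (real \<Rightarrow> real) \<Rightarrow> real \<Rightarrow> real \<Rightarrow> real \<Rightarrow> bool" where
  "has_RS_integral g W a b I \<longleftrightarrow>
     (\<forall>\<epsilon>>0. \<exists>\<delta>>0. \<forall>p. p tagged_division_of {a..b} \<and> (\<lambda>x. ball x \<delta>) fine p \<longrightarrow>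
        \<bar>(\<Sum>(x, k)\<in>p. g x * (W (Sup k) - W (Inf k))) - I\<bar> < \<epsilon>)"

definition RS_integral ::
  "real \<Rightarrow> real \<Rightarrow> (real \<Rightarrow> real) \<Rightarrow> (real \<Rightarrow> real) \<Rightarrow> real" where
  "RS_integral a b g W = (THE I. has_RS_integral g W a b I)"

definition points_of_increase :: "real \<Rightarrow> real \<Rightarrow> (real \<Rightarrow> real) \<Rightarrow> real set" where
  "points_of_increase a b W =
     {t \<in> {a..b}. \<forall>U. open U \<and> t \<in> U \<longrightarrow> \<not> W constant_on (U \<inter> {a..b})}"

definition W_sub :: "(real \<Rightarrow> real) \<Rightarrow> real \<Rightarrow> real \<Rightarrow> real" where
  "W_sub W h y = - W (- ln y / h)"

definition W_hat :: "(real \<Rightarrow> real) \<Rightarrow> real \<Rightarrow> real \<Rightarrow> real \<Rightarrow> real" where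
  "W_hat W b h y = RS_integral (exp (- b * h)) y (\<lambda>Y. 1 + Y) (W_sub W h)"

text \<open>
  The nodes \<open>y\<close> and weights \<open>d\<close> are indexed by \<open>{1..M}\<close>; their values elsewhere are irrelevant.
\<close>

definition gaussian_quadrature ::
  "nat \<Rightarrow> real \<Rightarrow> real \<Rightarrow> (real \<Rightarrow> real) \<Rightarrow> (nat \<Rightarrow> real) \<Rightarrow> (nat \<Rightarrow> real) \<Rightarrow> bool" where
  "gaussian_quadrature M \<alpha> \<beta> V y d \<longleftrightarrow>
     strict_mono_on {1..M} y \<and>
     (\<forall>\<nu>\<in>{1..M}. \<alpha> < y \<nu> \<and> y \<nu> < \<beta> \<and> 0 < d \<nu>) \<and>
     (\<forall>i<2 * M. RS_integral \<alpha> \<beta> (\<lambda>t. t ^ i) V = (\<Sum>\<nu>=1..M. d \<nu> * y \<nu> ^ i))"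

definition h_crit :: "real \<Rightarrow> real" where
  "h_crit r = (THE h. 0 < h \<and> (1 - r) * exp (- h) + exp (- (1 - r) * h) - r = 0)"

end

theory Submission
  imports Defs
begin

text \<open>
  After the substitution \<open>x = exp (- t * h)\<close> the quantity to estimate is the error of Gaussian
  quadrature, with respect to \<open>(1 + x) dV\<close>, on the function \<open>1 / (1 + x)\<close>. For every polynomial
  \<open>q\<close> of degree at most \<open>2 * M\<close> with \<open>q (-1) = 1\<close> this error equals the integral of \<open>q\<close> against
  \<open>dV\<close> minus a combination of the values of \<open>q\<close> at the nodes with positive coefficients. The squared
  node polynomial gives positivity. The squared Chebyshev polynomial of the interval gives the upper
  bound, even with the constant 4 in place of \<open>(s + 1)\<^sup>2\<close>.

  The bound increases with \<open>s > 1\<close>, so the remaining claims concern the maximum of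
  \<open>s\<^sup>2 = (1 + exp (- r * t)) / (1 + exp (- t))\<close> over \<open>t = b * h\<close>. It is found from the tangent
  inequality \<open>exp (r * w) \<le> 1 - r + r * exp w\<close> with \<open>w = h_crit r - t\<close>.
\<close>

section \<open>Riemann-Stieltjes integral: uniqueness and criteria for existence\<close>

text \<open>By Cousin's lemma some tagged division is fine for the smaller of both radii; its sum
  would lie within half of \<open>\<bar>I - J\<bar>\<close> of each value.\<close>

lemma has_RS_integral_unique:
  assumes "has_RS_integral g W a b I" "has_RS_integral g W a b J"
  shows "I = J"
proof (rule ccontr)
  assume "I \<noteq> J"
  define e where "e = \<bar>I - J\<bar> / 2"
  with \<open>I \<noteq> J\<close> have e: "e > 0" by simp
  define S where "S = (\<lambda>p. \<Sum>(x, k)\<in>p. g x * (W (Sup k) - W (Inf k)))"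
  obtain d1 where d1: "d1 > 0" "\<And>p. p tagged_division_of {a..b} \<Longrightarrow> (\<lambda>x. ball x d1) fine p \<Longrightarrow>
      \<bar>S p - I\<bar> < e"
    using assms(1)[unfolded has_RS_integral_def, folded S_def, rule_format, OF e] by meson
  obtain d2 where d2: "d2 > 0" "\<And>p. p tagged_division_of {a..b} \<Longrightarrow> (\<lambda>x. ball x d2) fine p \<Longrightarrow>
      \<bar>S p - J\<bar> < e"
    using assms(2)[unfolded has_RS_integral_def, folded S_def, rule_format, OF e] by meson
  have "gauge (\<lambda>x::real. ball x (min d1 d2))"
    using d1(1) d2(1) by (intro gauge_ball) simp
  then obtain p where p: "p tagged_division_of {a..b}" "(\<lambda>x. ball x (min d1 d2)) fine p"
    by (rule fine_division_exists_real)
  have "(\<lambda>x. ball x d1) fine p" "(\<lambda>x. ball x d2) fine p"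
    using p(2) by (simp_all add: ball_min_Int fine_Int)
  with p(1) have "\<bar>S p - I\<bar> < e" "\<bar>S p - J\<bar> < e"
    by (auto intro: d1(2) d2(2))
  moreover have "\<bar>I - J\<bar> \<le> \<bar>S p - I\<bar> + \<bar>S p - J\<bar>" by linarith
  ultimately show False by (simp add: e_def)
qed

lemma RS_integral_eqI: "has_RS_integral g W a b I \<Longrightarrow> RS_integral a b g W = I"
  unfolding RS_integral_def by (blast intro: has_RS_integral_unique)

text \<open>Increments of \<open>G\<close> and of \<open>V\<close> telescope over a tagged division,
  so the errors on the cells add up to at most \<open>\<epsilon>\<close> times the total increase of
  \<open>V\<close>.\<close>

lemma has_RS_integral_if_increments:
  fixes g U V G :: "real \<Rightarrow> real"
  assumes "a \<le> b" and "mono_on {a..b} V"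
    and approx: "\<And>\<epsilon>. \<epsilon> > 0 \<Longrightarrow> \<exists>\<delta>>0. \<forall>u x v. a \<le> u \<and> u \<le> x \<and> x \<le> v \<and> v \<le> b \<and> v - u < \<delta> \<longrightarrow>
      \<bar>g x * (U v - U u) - (G v - G u)\<bar> \<le> \<epsilon> * (V v - V u)"
  shows "has_RS_integral g U a b (G b - G a)"
  unfolding has_RS_integral_def
proof (intro allI impI)
  fix \<epsilon> :: real assume "\<epsilon> > 0"
  have ab: "V a \<le> V b" using assms(1,2) by (auto intro: mono_onD)
  \<comment> \<open>The added 1 keeps the denominator positive when \<open>V\<close> is constant and
    makes the final inequality strict.\<close>
  define e where "e = \<epsilon> / (V b - V a + 1)"
  have e: "e > 0" using ab \<open>\<epsilon> > 0\<close> by (simp add: e_def)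
  have "e * (V b - V a) < e * (V b - V a + 1)" using e by simp
  also have "\<dots> = \<epsilon>" using ab by (simp add: e_def)
  finally have small: "e * (V b - V a) < \<epsilon>" .
  obtain \<delta> where \<delta>: "\<delta> > 0" "\<And>u x v. a \<le> u \<Longrightarrow> u \<le> x \<Longrightarrow> x \<le> v \<Longrightarrow> v \<le> b \<Longrightarrow> v - u < \<delta> \<Longrightarrow>
      \<bar>g x * (U v - U u) - (G v - G u)\<bar> \<le> e * (V v - V u)"
    using approx[OF e] by blast
  show "\<exists>\<delta>>0. \<forall>p. p tagged_division_of {a..b} \<and> (\<lambda>x. ball x \<delta>) fine p \<longrightarrow>
      \<bar>(\<Sum>(x, k)\<in>p. g x * (U (Sup k) - U (Inf k))) - (G b - G a)\<bar> < \<epsilon>"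
  \<comment> \<open>A cell inside a ball of radius \<open>\<delta> / 2\<close> is shorter than
    \<open>\<delta>\<close>.\<close>
  proof (intro exI[of _ "\<delta> / 2"] conjI allI impI)
    show "\<delta> / 2 > 0" using \<delta>(1) by simp
    fix p assume p: "p tagged_division_of {a..b} \<and> (\<lambda>x. ball x (\<delta> / 2)) fine p"
    have cell: "\<bar>g x * (U (Sup k) - U (Inf k)) - (G (Sup k) - G (Inf k))\<bar> \<le> e * (V (Sup k) - V (Inf k))"
      if xk: "(x, k) \<in> p" for x k
    proof -
      have x: "x \<in> k" "k \<subseteq> {a..b}"
        using tagged_division_ofD(2,3)[OF conjunct1[OF p] xk] by auto
      obtain u v where k: "k = {u..v}"
        using tagged_division_ofD(4)[OF conjunct1[OF p] xk] by auto
      have uv: "u \<le> x" "x \<le> v" using x(1) k by auto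
      have "k \<subseteq> ball x (\<delta> / 2)" using p xk by (auto simp: fine_def)
      moreover have "u \<in> k" "v \<in> k" using k uv by auto
      ultimately have "u \<in> ball x (\<delta> / 2)" "v \<in> ball x (\<delta> / 2)" by blast+
      then have "\<bar>x - u\<bar> < \<delta> / 2" "\<bar>x - v\<bar> < \<delta> / 2" by (simp_all only: mem_ball dist_real_def)
      then have "v - u < \<delta>" by linarith
      moreover have "a \<le> u" "v \<le> b" using x(2) k uv by auto
      ultimately show ?thesis using \<delta>(2)[of u x v] uv by (simp add: k)
    qed
    have tel: "(\<Sum>(x, k)\<in>p. F (Sup k) - F (Inf k)) = F b - F a" for F :: "real \<Rightarrow> real"
      using additive_tagged_division_1[OF \<open>a \<le> b\<close>] p by blast
    have "(\<Sum>(x, k)\<in>p. g x * (U (Sup k) - U (Inf k))) - (G b - G a)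
        = (\<Sum>(x, k)\<in>p. g x * (U (Sup k) - U (Inf k)) - (G (Sup k) - G (Inf k)))"
      unfolding tel[symmetric, of G] by (simp add: sum_subtractf split_def)
    also have "\<bar>\<dots>\<bar> \<le> (\<Sum>(x, k)\<in>p. e * (V (Sup k) - V (Inf k)))"
      using cell by (intro order_trans[OF sum_abs] sum_mono) auto
    also have "\<dots> = e * (V b - V a)"
      unfolding tel[symmetric, of V] by (simp add: sum_distrib_left split_def)
    finally show "\<bar>(\<Sum>(x, k)\<in>p. g x * (U (Sup k) - U (Inf k))) - (G b - G a)\<bar> < \<epsilon>"
      using small by linarith
  qed
qed

text \<open>Here \<open>dU = \<phi> dV\<close>, and \<open>G\<close> is an indefinite integral of
  \<open>g * \<phi>\<close> against \<open>dV\<close>, both encoded by mean value properties.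
  Uniform continuity lets the mean value points be replaced by the tag.\<close>

lemma has_RS_integral_density:
  fixes g \<phi> U V G :: "real \<Rightarrow> real"
  assumes "a \<le> b" and mono: "mono_on {a..b} V"
    and cont: "continuous_on {a..b} g" "continuous_on {a..b} \<phi>"
    and U: "\<And>u v. a \<le> u \<Longrightarrow> u \<le> v \<Longrightarrow> v \<le> b \<Longrightarrow> \<exists>c\<in>{u..v}. U v - U u = \<phi> c * (V v - V u)"
    and G: "\<And>u v. a \<le> u \<Longrightarrow> u \<le> v \<Longrightarrow> v \<le> b \<Longrightarrow> \<exists>c\<in>{u..v}. G v - G u = g c * \<phi> c * (V v - V u)"
  shows "has_RS_integral g U a b (G b - G a)"
proof (rule has_RS_integral_if_increments[OF \<open>a \<le> b\<close> mono])
  fix \<epsilon> :: real assume "\<epsilon> > 0"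
  have "bounded (g ` {a..b})"
    using cont(1) by (simp add: compact_continuous_image compact_imp_bounded)
  then obtain B where B: "B > 0" "\<And>x. x \<in> {a..b} \<Longrightarrow> \<bar>g x\<bar> \<le> B"
    unfolding bounded_pos by auto
  have "uniformly_continuous_on {a..b} \<phi>" "uniformly_continuous_on {a..b} (\<lambda>x. g x * \<phi> x)"
    using cont by (auto intro!: compact_uniformly_continuous continuous_intros)
  note unif = this[unfolded uniformly_continuous_on_def dist_real_def, rule_format]
  \<comment> \<open>The error splits into \<open>g x * (\<phi> c - \<phi> x)\<close> and
    \<open>g c' * \<phi> c' - g x * \<phi> x\<close>, each allowed \<open>\<epsilon> / 2\<close>;
    dividing by \<open>B\<close> absorbs the factor \<open>g x\<close> of the first.\<close>
  have e: "\<epsilon> / 2 / B > 0" "\<epsilon> / 2 > 0" using \<open>\<epsilon> > 0\<close> B(1) by simp_all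
  obtain d1 where d1: "d1 > 0" "\<And>x y. x \<in> {a..b} \<Longrightarrow> y \<in> {a..b} \<Longrightarrow> \<bar>y - x\<bar> < d1 \<Longrightarrow> \<bar>\<phi> y - \<phi> x\<bar> < \<epsilon> / 2 / B"
    using unif(1)[OF e(1)] by meson
  obtain d2 where d2: "d2 > 0" "\<And>x y. x \<in> {a..b} \<Longrightarrow> y \<in> {a..b} \<Longrightarrow> \<bar>y - x\<bar> < d2 \<Longrightarrow>
        \<bar>g y * \<phi> y - g x * \<phi> x\<bar> < \<epsilon> / 2"
    using unif(2)[OF e(2)] by meson
  show "\<exists>\<delta>>0. \<forall>u x v. a \<le> u \<and> u \<le> x \<and> x \<le> v \<and> v \<le> b \<and> v - u < \<delta> \<longrightarrow>
      \<bar>g x * (U v - U u) - (G v - G u)\<bar> \<le> \<epsilon> * (V v - V u)"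
  proof (intro exI[of _ "min d1 d2"] conjI allI impI)
    show "min d1 d2 > 0" using d1(1) d2(1) by simp
    fix u x v assume *: "a \<le> u \<and> u \<le> x \<and> x \<le> v \<and> v \<le> b \<and> v - u < min d1 d2"
    then obtain c where c: "c \<in> {u..v}" "U v - U u = \<phi> c * (V v - V u)"
      using U[of u v] by auto
    obtain c' where c': "c' \<in> {u..v}" "G v - G u = g c' * \<phi> c' * (V v - V u)"
      using G[of u v] * by auto
    have V: "V u \<le> V v" using * mono by (auto intro: mono_onD)
    have "\<bar>\<phi> c - \<phi> x\<bar> < \<epsilon> / 2 / B"
      using * c(1) by (intro d1(2)) auto
    moreover have "\<bar>g x\<bar> \<le> B" using * by (intro B(2)) auto
    ultimately have "\<bar>g x\<bar> * \<bar>\<phi> c - \<phi> x\<bar> \<le> B * (\<epsilon> / 2 / B)"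
      using B(1) by (intro mult_mono) auto
    then have 1: "\<bar>g x * (\<phi> c - \<phi> x)\<bar> \<le> \<epsilon> / 2" using B(1) by (simp add: abs_mult)
    have 2: "\<bar>g c' * \<phi> c' - g x * \<phi> x\<bar> \<le> \<epsilon> / 2"
      using * c'(1) by (intro less_imp_le d2(2)) auto
    have "g x * (U v - U u) - (G v - G u)
        = (g x * (\<phi> c - \<phi> x) - (g c' * \<phi> c' - g x * \<phi> x)) * (V v - V u)"
      unfolding c(2) c'(2) by (simp add: algebra_simps)
    moreover have "\<bar>g x * (\<phi> c - \<phi> x) - (g c' * \<phi> c' - g x * \<phi> x)\<bar> \<le> \<epsilon>"
      using 1 2 by linarith
    ultimately show "\<bar>g x * (U v - U u) - (G v - G u)\<bar> \<le> \<epsilon> * (V v - V u)"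
      using V by (simp add: abs_mult mult_right_mono)
  qed
qed

section \<open>Integrals of polynomials against a monotone integrator\<close>

lemma continuous_on_poly_id: "continuous_on S (poly (p :: real poly))"
  by (simp add: continuous_at_imp_continuous_on poly_isCont)

text \<open>Integration by parts turns the integral of a polynomial into a Henstock--Kurzweil integral of
  the monotone integrator, which exists without any continuity assumption.\<close>

definition poly_RS :: "(real \<Rightarrow> real) \<Rightarrow> real \<Rightarrow> real \<Rightarrow> real poly \<Rightarrow> real" where
  "poly_RS V u v p =
     poly p v * V v - poly p u * V u - integral {u..v} (\<lambda>x. V x * poly (pderiv p) x)"

lemma integral_pderiv:
  fixes p :: "real poly"
  assumes "u \<le> v"
  shows "integral {u..v} (poly (pderiv p)) = poly p v - poly p u"
proof (rule integral_unique, rule fundamental_theorem_of_calculus[OF assms])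
  fix x
  show "(poly p has_vector_derivative poly (pderiv p) x) (at x within {u..v})"
    unfolding has_real_derivative_iff_has_vector_derivative[symmetric]
    by (rule has_field_derivative_at_within[OF poly_DERIV])
qed

text \<open>The second mean value theorem, applied to \<open>pderiv p\<close> with the monotone
  factor \<open>V\<close>, splits the integral at some \<open>c\<close>; the boundary terms of the
  integration by parts then cancel.\<close>

lemma poly_RS_mean_value:
  assumes "u \<le> v" and "mono_on {u..v} V"
  shows "\<exists>c\<in>{u..v}. poly_RS V u v p = poly p c * (V v - V u)"
proof -
  have "poly (pderiv p) integrable_on {u..v}"
    by (rule integrable_continuous_interval[OF continuous_on_poly_id])
  then obtain c where c: "c \<in> {u..v}" and
    "integral {u..v} (\<lambda>x. V x * poly (pderiv p) x)
      = V u * integral {u..c} (poly (pderiv p)) + V v * integral {c..v} (poly (pderiv p))"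
    by (rule second_mean_value_theorem[where g = V, OF _ assms(1)]) (auto intro: mono_onD[OF assms(2)])
  then have "poly_RS V u v p = poly p c * (V v - V u)"
    by (simp add: poly_RS_def integral_pderiv algebra_simps)
  with c show ?thesis by blast
qed

lemma mono_on_times_poly_integrable:
  fixes V :: "real \<Rightarrow> real"
  assumes "mono_on {u..v} V"
  shows "(\<lambda>x. V x * poly p x) integrable_on {u..v}"
proof (cases "u \<le> v")
  case True
  have "poly p integrable_on {u..v}"
    by (rule integrable_continuous_interval[OF continuous_on_poly_id])
  then obtain c where "((\<lambda>x. V x * poly p x) has_integral
      V u * integral {u..c} (poly p) + V v * integral {c..v} (poly p)) {u..v}"
    by (rule second_mean_value_theorem_full[where g = V, OF _ True]) (auto intro: mono_onD[OF assms])
  then show ?thesis by (rule has_integral_integrable)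
qed auto

lemma poly_RS_combine:
  assumes "u \<le> v" "v \<le> w" "mono_on {u..w} V"
  shows "poly_RS V u v p + poly_RS V v w p = poly_RS V u w p"
  using Henstock_Kurzweil_Integration.integral_combine[OF assms(1,2)
      mono_on_times_poly_integrable[OF assms(3)], of "pderiv p"]
  by (simp add: poly_RS_def)

lemma poly_RS_add:
  assumes "mono_on {u..v} V"
  shows "poly_RS V u v (p + q) = poly_RS V u v p + poly_RS V u v q"
  using assms by (simp add: poly_RS_def pderiv_add algebra_simps
      Henstock_Kurzweil_Integration.integral_add mono_on_times_poly_integrable)

lemma poly_RS_smult: "poly_RS V u v (smult k p) = k * poly_RS V u v p"
  by (simp add: poly_RS_def pderiv_smult algebra_simps)

lemma poly_RS_0: "poly_RS V u v 0 = 0"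
  by (simp add: poly_RS_def)

lemma poly_RS_sum:
  assumes "mono_on {u..v} V"
  shows "poly_RS V u v (\<Sum>i\<in>A. p i) = (\<Sum>i\<in>A. poly_RS V u v (p i))"
  by (induction A rule: infinite_finite_induct) (simp_all add: poly_RS_0 poly_RS_add assms)

lemma poly_RS_1: "poly_RS V u v 1 = V v - V u"
  by (simp add: poly_RS_def)

text \<open>Taking \<open>q = 1\<close> gives the integral against \<open>V\<close> itself; taking
  \<open>q = 1 + x\<close> gives the integral against the integrator of the quadrature.\<close>

lemma has_RS_integral_density_poly:
  assumes "a \<le> b" "mono_on {a..b} V"
    and U: "\<And>u v. a \<le> u \<Longrightarrow> u \<le> v \<Longrightarrow> v \<le> b \<Longrightarrow> U v - U u = poly_RS V u v q"
  shows "has_RS_integral (poly p) U a b (poly_RS V a b (p * q))"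
proof -
  define G where "G x = poly_RS V a x (p * q)" for x
  have m: "mono_on {u..v} V" if "a \<le> u" "v \<le> b" for u v
    using assms(2) by (rule mono_on_subset) (use that in auto)
  have G: "G v - G u = poly_RS V u v (p * q)" if "a \<le> u" "u \<le> v" "v \<le> b" for u v
    using poly_RS_combine[of a u v V "p * q"] that m[of a v] by (simp add: G_def)
  have "has_RS_integral (poly p) U a b (G b - G a)"
  proof (rule has_RS_integral_density[OF assms(1,2), where \<phi> = "poly q"])
    show "\<exists>c\<in>{u..v}. U v - U u = poly q c * (V v - V u)" if "a \<le> u" "u \<le> v" "v \<le> b" for u v
      using U[OF that] poly_RS_mean_value[OF that(2) m[OF that(1,3)]] by simp
    show "\<exists>c\<in>{u..v}. G v - G u = poly p c * poly q c * (V v - V u)" if "a \<le> u" "u \<le> v" "v \<le> b" for u v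
      using G[OF that] poly_RS_mean_value[OF that(2) m[OF that(1,3)], of "p * q"] by simp
  qed (rule continuous_on_poly_id)+
  then show ?thesis using G[of a b] assms(1) by simp
qed

lemma has_RS_integral_poly:
  assumes "a \<le> b" "mono_on {a..b} V"
  shows "has_RS_integral (poly p) V a b (poly_RS V a b p)"
  using has_RS_integral_density_poly[OF assms, of V 1 p] by (simp add: poly_RS_1)

section \<open>Chebyshev polynomials of the first kind\<close>

fun chebyshev :: "nat \<Rightarrow> real poly" where
  "chebyshev 0 = 1"
| "chebyshev (Suc 0) = [:0, 1:]"
| "chebyshev (Suc (Suc n)) = [:0, 2:] * chebyshev (Suc n) - chebyshev n"

lemma degree_chebyshev: "degree (chebyshev n) \<le> n"
proof (induction n rule: chebyshev.induct)
  case (3 n)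
  have "degree ([:0, 2:] * chebyshev (Suc n)) \<le> Suc (Suc n)"
    using 3 degree_mult_le[of "[:0, 2:]" "chebyshev (Suc n)"] by simp
  with 3 show ?case by (auto intro!: degree_diff_le simp del: mult_pCons_left)
qed auto

lemma poly_chebyshev_cos: "poly (chebyshev n) (cos t) = cos (n * t)"
proof (induction n rule: chebyshev.induct)
  case (3 n)
  have "cos (real (Suc (Suc n)) * t) + cos (n * t) = 2 * cos t * cos (real (Suc n) * t)"
    using cos_add[of "real (Suc n) * t" t] cos_diff[of "real (Suc n) * t" t]
    by (simp add: algebra_simps)
  with 3 show ?case by simp
qed auto

lemma abs_poly_chebyshev_le:
  assumes "\<bar>x\<bar> \<le> 1"
  shows "\<bar>poly (chebyshev n) x\<bar> \<le> 1"
  using poly_chebyshev_cos[of n "arccos x"] assms by (simp add: cos_arccos_abs)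

text \<open>The counterpart of the cosine formula outside the interval from -1 to 1: for positive
  \<open>z\<close> it shows growth at least like \<open>z ^ n / 2\<close>.\<close>

lemma poly_chebyshev_joukowski:
  assumes "z \<noteq> 0"
  shows "poly (chebyshev n) ((z + 1 / z) / 2) = (z ^ n + 1 / z ^ n) / 2"
proof (induction n rule: chebyshev.induct)
  case (3 n)
  have "poly (chebyshev (Suc (Suc n))) ((z + 1 / z) / 2)
      = (z + 1 / z) * ((z ^ Suc n + 1 / z ^ Suc n) / 2) - (z ^ n + 1 / z ^ n) / 2"
    using 3 by (simp only: chebyshev.simps poly_diff poly_mult poly_pCons) simp
  also have "\<dots> = (z ^ Suc (Suc n) + 1 / z ^ Suc (Suc n)) / 2"
    using assms by (simp add: field_simps)
  finally show ?case .
qed (use assms in auto)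

section \<open>Positivity of the integral and the error of Gaussian quadrature\<close>

text \<open>Near \<open>t\<close> the polynomial stays positive while \<open>V\<close> takes two
  different values, so the mean value form gives a positive contribution there; the remaining two
  pieces are nonnegative.\<close>

lemma poly_RS_pos:
  assumes "mono_on {a..b} V" and nonneg: "\<And>x. x \<in> {a..b} \<Longrightarrow> 0 \<le> poly q x"
    and t: "t \<in> points_of_increase a b V" and "poly q t > 0"
  shows "poly_RS V a b q > 0"
proof -
  have m: "mono_on {u..v} V" if "a \<le> u" "v \<le> b" for u v
    using assms(1) by (rule mono_on_subset) (use that in auto)
  have ge: "poly_RS V u v q \<ge> 0" if uv: "a \<le> u" "u \<le> v" "v \<le> b" for u v
  proof -
    obtain c where "c \<in> {u..v}" "poly_RS V u v q = poly q c * (V v - V u)"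
      using poly_RS_mean_value[OF uv(2) m[OF uv(1,3)]] by blast
    moreover have "V u \<le> V v" using uv m[OF uv(1,3)] by (auto intro: mono_onD)
    ultimately show ?thesis using nonneg[of c] uv by auto
  qed
  have "open {x. poly q x > 0}"
    by (intro open_Collect_less continuous_on_const continuous_on_poly_id)
  with \<open>poly q t > 0\<close> obtain e where e: "e > 0" "ball t e \<subseteq> {x. poly q x > 0}"
    unfolding open_contains_ball by blast
  have "\<not> V constant_on (ball t e \<inter> {a..b})"
    using t e(1) unfolding points_of_increase_def by simp
  then obtain x y where xy: "x \<in> ball t e \<inter> {a..b}" "y \<in> ball t e \<inter> {a..b}" "V x \<noteq> V y"
    unfolding constant_on_def by metis
  define u v where "u = min x y" and "v = max x y"
  have u: "u \<in> ball t e \<inter> {a..b}" and v: "v \<in> ball t e \<inter> {a..b}" and "V u \<noteq> V v" "u \<le> v"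
    using xy by (auto simp: u_def v_def min_def max_def)
  moreover have "V u \<le> V v" using u v \<open>u \<le> v\<close> assms(1) by (auto intro: mono_onD)
  ultimately have less: "V u < V v" by simp
  have uv: "a \<le> u" "u \<le> v" "v \<le> b" using u v \<open>u \<le> v\<close> by auto
  obtain c where c: "c \<in> {u..v}" "poly_RS V u v q = poly q c * (V v - V u)"
    using poly_RS_mean_value[OF uv(2) m[OF uv(1,3)]] by blast
  have "\<bar>t - c\<bar> < e" using u v c(1) by (auto simp: dist_real_def)
  then have "poly q c > 0" using e(2) by (auto simp: dist_real_def subset_iff)
  then have "poly_RS V u v q > 0" using c(2) less by simp
  moreover have "poly_RS V a b q = poly_RS V a u q + poly_RS V u v q + poly_RS V v b q"
    using uv poly_RS_combine[of a u v V q] poly_RS_combine[of a v b V q] assms(1) m[of a v] by simp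
  ultimately show ?thesis using ge[of a u] ge[of v b] uv by simp
qed

text \<open>Dividing \<open>1 - q\<close> by \<open>1 + x\<close> leaves a polynomial to which the quadrature formula applies, so
  each \<open>q\<close> normalised at \<open>-1\<close> gives a representation of the quadrature error of \<open>1 / (1 + x)\<close>.\<close>

lemma gauss_error_eq:
  fixes V :: "real \<Rightarrow> real" and y d :: "nat \<Rightarrow> real"
  assumes "-1 < \<alpha>" "\<alpha> \<le> \<beta>" and V: "mono_on {\<alpha>..\<beta>} V" and "M \<ge> 1"
    and gq: "gaussian_quadrature M \<alpha> \<beta> (\<lambda>x. RS_integral \<alpha> x (\<lambda>Y. 1 + Y) V) y d"
    and q: "degree q \<le> 2 * M" "poly q (-1) = 1"
  shows "V \<beta> - V \<alpha> - (\<Sum>\<nu>=1..M. d \<nu> / (1 + y \<nu>))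
    = poly_RS V \<alpha> \<beta> q - (\<Sum>\<nu>=1..M. d \<nu> / (1 + y \<nu>) * poly q (y \<nu>))"
proof -
  define U where "U = (\<lambda>x. RS_integral \<alpha> x (\<lambda>Y. 1 + Y) V)"
  have m: "mono_on {\<alpha>..v} V" if "v \<le> \<beta>" for v
    using V by (rule mono_on_subset) (use that in auto)
  have lin: "(\<lambda>Y. 1 + Y) = poly [:1, 1::real:]" by auto
  have U: "U x = poly_RS V \<alpha> x [:1, 1:]" if "\<alpha> \<le> x" "x \<le> \<beta>" for x
    unfolding U_def lin by (intro RS_integral_eqI has_RS_integral_poly that m)
  \<comment> \<open>Thus \<open>U\<close> has density \<open>1 + x\<close> with respect to
    \<open>V\<close>, which turns the moments of \<open>U\<close> into integrals against
    \<open>V\<close>.\<close>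
  have Udiff: "U v - U u = poly_RS V u v [:1, 1:]" if "\<alpha> \<le> u" "u \<le> v" "v \<le> \<beta>" for u v
    using that U[of u] U[of v] poly_RS_combine[of \<alpha> u v V "[:1, 1:]"] m[of v] by simp
  have moment: "poly_RS V \<alpha> \<beta> (monom 1 i * [:1, 1:]) = (\<Sum>\<nu>=1..M. d \<nu> * y \<nu> ^ i)"
    if "i < 2 * M" for i
  proof -
    have "has_RS_integral (poly (monom 1 i)) U \<alpha> \<beta> (poly_RS V \<alpha> \<beta> (monom 1 i * [:1, 1:]))"
      using has_RS_integral_density_poly[OF assms(2) V Udiff] by simp
    then have "RS_integral \<alpha> \<beta> (\<lambda>t. t ^ i) U = poly_RS V \<alpha> \<beta> (monom 1 i * [:1, 1:])"
      by (intro RS_integral_eqI) (simp add: poly_monom[abs_def])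
    with gq that show ?thesis unfolding gaussian_quadrature_def U_def by simp
  qed
  have exact: "poly_RS V \<alpha> \<beta> (p * [:1, 1:]) = (\<Sum>\<nu>=1..M. d \<nu> * poly p (y \<nu>))"
    if "degree p \<le> 2 * M - 1" for p
  proof -
    have p: "p = (\<Sum>i\<le>2 * M - 1. smult (coeff p i) (monom 1 i))"
      using poly_as_sum_of_monoms'[OF that] by (simp add: smult_monom)
    have "p * [:1, 1:] = (\<Sum>i\<le>2 * M - 1. smult (coeff p i) (monom 1 i * [:1, 1:]))"
      by (subst (1) p, simp only: sum_distrib_right mult_smult_left)
    then have "poly_RS V \<alpha> \<beta> (p * [:1, 1:])
        = (\<Sum>i\<le>2 * M - 1. coeff p i * poly_RS V \<alpha> \<beta> (monom 1 i * [:1, 1:]))"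
      by (simp only: poly_RS_sum[OF V] poly_RS_smult)
    also have "\<dots> = (\<Sum>i\<le>2 * M - 1. \<Sum>\<nu>=1..M. d \<nu> * (coeff p i * y \<nu> ^ i))"
    proof (intro sum.cong refl)
      fix i assume "i \<in> {..2 * M - 1}"
      then have "i < 2 * M" using \<open>M \<ge> 1\<close> by auto
      then show "coeff p i * poly_RS V \<alpha> \<beta> (monom 1 i * [:1, 1:])
          = (\<Sum>\<nu>=1..M. d \<nu> * (coeff p i * y \<nu> ^ i))"
        by (simp only: moment sum_distrib_left) (simp add: mult_ac)
    qed
    also have "\<dots> = (\<Sum>\<nu>=1..M. d \<nu> * poly (\<Sum>i\<le>2 * M - 1. smult (coeff p i) (monom 1 i)) (y \<nu>))"
      by (subst sum.swap) (simp add: poly_sum poly_monom sum_distrib_left)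
    finally show ?thesis using p by simp
  qed
  have "[:1, 1:] dvd 1 - q"
    using poly_eq_0_iff_dvd[of "1 - q" "-1"] q(2) by simp
  then obtain p where p: "1 - q = [:1, 1:] * p" by (rule dvdE)
  \<comment> \<open>Splitting off the linear factor lowers the degree from \<open>2 * M\<close> to
    exactly the range where the quadrature is exact. The product formula for degrees requires
    \<open>p \<noteq> 0\<close>.\<close>
  have "degree p \<le> 2 * M - 1"
  proof (cases "p = 0")
    case False
    have "degree (1 - q) = degree [:1, 1::real:] + degree p"
      unfolding p using False by (intro degree_mult_eq) auto
    moreover have "degree (1 - q) \<le> 2 * M" using q(1) by (intro degree_diff_le) auto
    ultimately show ?thesis by simp
  qed simp
  note exact[OF this]
  moreover have "p * [:1, 1:] = 1 + smult (-1) q" using p by (simp add: mult.commute)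
  ultimately have "V \<beta> - V \<alpha> - poly_RS V \<alpha> \<beta> q = (\<Sum>\<nu>=1..M. d \<nu> * poly p (y \<nu>))"
    using poly_RS_add[OF V, of 1 "smult (-1) q"] by (simp only: poly_RS_1 poly_RS_smult)
  also have "\<dots> = (\<Sum>\<nu>=1..M. d \<nu> / (1 + y \<nu>) - d \<nu> / (1 + y \<nu>) * poly q (y \<nu>))"
  proof (intro sum.cong refl)
    fix \<nu> assume "\<nu> \<in> {1..M}"
    then have "\<alpha> < y \<nu>" using gq by (auto simp: gaussian_quadrature_def)
    then have "1 + y \<nu> > 0" using assms(1) by simp
    moreover have "1 - poly q (y \<nu>) = (1 + y \<nu>) * poly p (y \<nu>)"
      using arg_cong[OF p, of "\<lambda>p. poly p (y \<nu>)"] by (simp add: distrib_right)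
    ultimately have "d \<nu> * poly p (y \<nu>) = d \<nu> / (1 + y \<nu>) * (1 - poly q (y \<nu>))"
      by simp
    then show "d \<nu> * poly p (y \<nu>) = d \<nu> / (1 + y \<nu>) - d \<nu> / (1 + y \<nu>) * poly q (y \<nu>)"
      by (simp only: right_diff_distrib mult_1_right)
  qed
  finally show ?thesis by (simp add: sum_subtractf)
qed

text \<open>With \<open>q\<close> the squared node polynomial, normalised at -1, the node sum in
  \<open>gauss_error_eq\<close> vanishes and the error is the integral of \<open>q\<close>, which is
  positive by \<open>poly_RS_pos\<close>.\<close>

lemma gauss_error_pos:
  fixes V :: "real \<Rightarrow> real" and y d :: "nat \<Rightarrow> real"
  assumes "-1 < \<alpha>" "\<alpha> \<le> \<beta>" and V: "mono_on {\<alpha>..\<beta>} V" and "M \<ge> 1"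
    and gq: "gaussian_quadrature M \<alpha> \<beta> (\<lambda>x. RS_integral \<alpha> x (\<lambda>Y. 1 + Y) V) y d"
    and S: "S \<subseteq> points_of_increase \<alpha> \<beta> V" "finite S" "card S = M + 1"
  shows "(\<Sum>\<nu>=1..M. d \<nu> / (1 + y \<nu>)) < V \<beta> - V \<alpha>"
proof -
  define w where "w = (\<Prod>\<nu>=1..M. [:- y \<nu>, 1:])"
  have pw: "poly w x = (\<Prod>\<nu>=1..M. x - y \<nu>)" for x by (simp add: w_def poly_prod)
  have "degree w \<le> (\<Sum>\<nu>=1..M. degree [:- y \<nu>, 1:])"
    unfolding w_def using degree_prod_sum_le[of "{1..M}" "\<lambda>\<nu>. [:- y \<nu>, 1:]"] by (simp add: o_def)
  then have "degree w \<le> M" by simp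
  have ynodes: "\<alpha> < y \<nu>" if "\<nu> \<in> {1..M}" for \<nu>
    using gq that by (auto simp: gaussian_quadrature_def)
  have w1: "poly w (-1) \<noteq> 0" unfolding pw using ynodes assms(1) by force
  define q where "q = smult (1 / (poly w (-1))\<^sup>2) (w\<^sup>2)"
  have q: "poly q x = (poly w x / poly w (-1))\<^sup>2" for x
    by (simp add: q_def power_divide)
  \<comment> \<open>The \<open>M + 1\<close> points of increase cannot all be among at most
    \<open>M\<close> nodes, so \<open>q\<close> is positive at one of them.\<close>
  have "\<not> S \<subseteq> y ` {1..M}"
  proof
    assume "S \<subseteq> y ` {1..M}"
    then have "card S \<le> card (y ` {1..M})" by (intro card_mono) auto
    also have "\<dots> \<le> M" using card_image_le[of "{1..M}" y] by simp
    finally show False using S(3) by simp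
  qed
  then obtain t where t: "t \<in> S" "t \<notin> y ` {1..M}" by blast
  then have "poly w t \<noteq> 0" unfolding pw by auto
  then have "poly q t > 0" using w1 by (simp add: q)
  then have "poly_RS V \<alpha> \<beta> q > 0" using S(1) t(1) by (intro poly_RS_pos[OF V]) (auto simp: q)
  moreover have "degree q \<le> 2 * M"
    using \<open>degree w \<le> M\<close> degree_power_le[of w 2] by (simp add: q_def)
  moreover have "poly q (-1) = 1" using w1 by (simp add: q)
  moreover have "poly q (y \<nu>) = 0" if "\<nu> \<in> {1..M}" for \<nu>
    using that by (auto simp: q pw)
  ultimately show ?thesis
    using gauss_error_eq[OF assms(1-5), of q] by simp
qed

lemma gauss_error_upper:
  fixes V :: "real \<Rightarrow> real" and y d :: "nat \<Rightarrow> real"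
  assumes "-1 < \<alpha>" "\<alpha> < \<beta>" and V: "mono_on {\<alpha>..\<beta>} V" and "M \<ge> 1"
    and gq: "gaussian_quadrature M \<alpha> \<beta> (\<lambda>x. RS_integral \<alpha> x (\<lambda>Y. 1 + Y) V) y d"
  defines "s \<equiv> sqrt ((1 + \<beta>) / (1 + \<alpha>))"
  shows "V \<beta> - V \<alpha> - (\<Sum>\<nu>=1..M. d \<nu> / (1 + y \<nu>))
    \<le> 4 * ((s - 1) / (s + 1)) ^ (2 * M) * (V \<beta> - V \<alpha>)"
proof -
  have le: "\<alpha> \<le> \<beta>" using assms(2) by simp
  have "(1 + \<beta>) / (1 + \<alpha>) > 1" using assms(1,2) by simp
  then have s: "s > 1" and s2: "s\<^sup>2 = (1 + \<beta>) / (1 + \<alpha>)" unfolding s_def by auto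
  \<comment> \<open>Chosen so that \<open>(\<rho> + 1 / \<rho>) / 2\<close> is the image of -1 under
    the map \<open>L\<close> below.\<close>
  define \<rho> where "\<rho> = (s + 1) / (s - 1)"
  have \<rho>: "\<rho> > 0" using s by (simp add: \<rho>_def)
  \<comment> \<open>The affine map sending \<open>\<alpha>\<close> to 1 and \<open>\<beta>\<close>
    to -1. Reversing the orientation puts the image of -1 to the right of 1, which avoids a sign
    depending on \<open>M\<close>.\<close>
  define L where "L = [:(\<alpha> + \<beta>) / (\<beta> - \<alpha>), - 2 / (\<beta> - \<alpha>):]"
  define T where "T = pcompose (chebyshev M) L"
  have L: "poly L x = (\<alpha> + \<beta> - 2 * x) / (\<beta> - \<alpha>)" for x
    by (simp add: L_def diff_divide_distrib)
  have "(\<rho> + 1 / \<rho>) / 2 = (s\<^sup>2 + 1) / (s\<^sup>2 - 1)"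
  proof -
    have eq: "s\<^sup>2 - 1 = (s - 1) * (s + 1)" by algebra
    show ?thesis unfolding eq \<rho>_def using s
      by (simp add: divide_simps) (simp add: power2_eq_square algebra_simps)
  qed
  also have "\<dots> = ((1 + \<beta>) + (1 + \<alpha>)) / ((1 + \<beta>) - (1 + \<alpha>))"
  proof -
    have "(x / k + 1) / (x / k - 1) = (x + k) / (x - k)" if "0 < k" for x k :: real
    proof -
      have "x / k + 1 = (x + k) / k" "x / k - 1 = (x - k) / k" using that by (simp_all add: field_simps)
      then show ?thesis using that by simp
    qed
    then show ?thesis unfolding s2 using assms(1,2) by simp
  qed
  also have "\<dots> = poly L (-1)" by (simp add: L)
  finally have "poly T (-1) = (\<rho> ^ M + 1 / \<rho> ^ M) / 2"
    using poly_chebyshev_joukowski[of \<rho> M] \<rho> by (simp add: T_def poly_pcompose)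
  then have T1: "poly T (-1) \<ge> \<rho> ^ M / 2" using \<rho> by simp
  have T1pos: "\<rho> ^ M / 2 > 0" using \<rho> by simp
  have Tle: "\<bar>poly T x\<bar> \<le> 1" if "x \<in> {\<alpha>..\<beta>}" for x
  proof -
    have "\<bar>poly L x\<bar> \<le> 1" unfolding L using that assms(2) by (auto simp: abs_le_iff field_simps)
    then show ?thesis by (simp add: T_def poly_pcompose abs_poly_chebyshev_le)
  qed
  define q where "q = smult (1 / (poly T (-1))\<^sup>2) (T\<^sup>2)"
  have q: "poly q x = (poly T x / poly T (-1))\<^sup>2" for x
    by (simp add: q_def power_divide)
  have "degree L \<le> 1" by (simp add: L_def)
  then have "degree T \<le> M * 1"
    unfolding T_def degree_pcompose using degree_chebyshev[of M] by (intro mult_le_mono)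
  then have dq: "degree q \<le> 2 * M"
    using degree_power_le[of T 2] by (simp add: q_def)
  have q1: "poly q (-1) = 1" using T1 T1pos by (simp add: q)
  have "V \<beta> - V \<alpha> - (\<Sum>\<nu>=1..M. d \<nu> / (1 + y \<nu>))
    = poly_RS V \<alpha> \<beta> q - (\<Sum>\<nu>=1..M. d \<nu> / (1 + y \<nu>) * poly q (y \<nu>))"
    by (rule gauss_error_eq[OF assms(1) le assms(3-5) dq q1])
  also have "\<dots> \<le> poly_RS V \<alpha> \<beta> q"
  proof -
    have "0 \<le> d \<nu> / (1 + y \<nu>) * poly q (y \<nu>)" if "\<nu> \<in> {1..M}" for \<nu>
    proof -
      have "0 < d \<nu>" "\<alpha> < y \<nu>" using gq that by (auto simp: gaussian_quadrature_def)
      then show ?thesis using assms(1) by (simp add: q)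
    qed
    then show ?thesis using sum_nonneg by (smt (verit, best))
  qed
  also have "\<dots> \<le> 4 * (1 / \<rho>) ^ (2 * M) * (V \<beta> - V \<alpha>)"
  proof -
    obtain c where c: "c \<in> {\<alpha>..\<beta>}" "poly_RS V \<alpha> \<beta> q = poly q c * (V \<beta> - V \<alpha>)"
      using poly_RS_mean_value[OF le V] by blast
    \<comment> \<open>Squaring this quotient, at most \<open>2 / \<rho> ^ M\<close>, produces the
      constant 4.\<close>
    have "\<bar>poly T c / poly T (-1)\<bar> \<le> 1 / (\<rho> ^ M / 2)"
      using Tle[OF c(1)] T1 T1pos by (simp only: abs_divide) (intro frac_le, auto)
    then have "poly q c \<le> (1 / (\<rho> ^ M / 2))\<^sup>2"
      unfolding q by (metis abs_le_square_iff abs_of_nonneg abs_ge_zero order_trans)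
    also have "\<dots> = 4 * (1 / \<rho>) ^ (2 * M)"
      by (simp add: power_divide power_mult_distrib power_even_eq)
    finally show ?thesis
      unfolding c(2) using V le by (intro mult_right_mono) (auto intro: mono_onD)
  qed
  finally show ?thesis by (simp add: \<rho>_def)
qed

section \<open>The substitution \<open>x = exp (- t * h)\<close>\<close>

text \<open>If the transformed function were constant near the image point, \<open>W\<close> would
  be constant on the preimage, which is open by continuity.\<close>

lemma points_of_increase_W_sub:
  assumes "0 < h" and t: "t \<in> points_of_increase a b W"
  shows "exp (- t * h) \<in> points_of_increase (exp (- b * h)) (exp (- a * h)) (W_sub W h)"
  unfolding points_of_increase_def
proof (intro CollectI conjI allI impI notI)
  have "a \<le> t" "t \<le> b" using t by (auto simp: points_of_increase_def)
  then show "exp (- t * h) \<in> {exp (- b * h)..exp (- a * h)}" using assms(1) by simp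
next
  fix N assume N: "open N \<and> exp (- t * h) \<in> N" and
    const: "W_sub W h constant_on N \<inter> {exp (- b * h)..exp (- a * h)}"
  then obtain k where k: "\<And>x. x \<in> N \<inter> {exp (- b * h)..exp (- a * h)} \<Longrightarrow> W_sub W h x = k"
    unfolding constant_on_def by blast
  define N' where "N' = (\<lambda>t. exp (- t * h)) -` N"
  have "open N'" unfolding N'_def using N by (intro open_vimage continuous_intros) auto
  moreover have "t \<in> N'" using N by (simp add: N'_def)
  ultimately have "\<not> W constant_on (N' \<inter> {a..b})"
    using t by (auto simp: points_of_increase_def)
  moreover have "W x = - k" if "x \<in> N' \<inter> {a..b}" for x
    using k[of "exp (- x * h)"] that assms(1) by (simp add: N'_def W_sub_def)
  ultimately show False unfolding constant_on_def by blast
qed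

text \<open>The order is reversed twice, by \<open>- ln y / h\<close> and by the outer minus
  sign.\<close>

lemma mono_on_W_sub:
  assumes "0 < h" "mono_on {a..b} W"
  shows "mono_on {exp (- b * h)..exp (- a * h)} (W_sub W h)"
proof (rule mono_onI)
  fix x y assume x: "x \<in> {exp (- b * h)..exp (- a * h)}" and y: "y \<in> {exp (- b * h)..exp (- a * h)}"
    and "x \<le> y"
  have pos: "0 < x" "0 < y" 
    using x y less_le_trans[OF exp_gt_zero[of "- b * h"]] by (simp_all only: atLeastAtMost_iff)
  have ran: "- ln z / h \<in> {a..b}" if "z \<in> {exp (- b * h)..exp (- a * h)}" "0 < z" for z
  proof -
    have "exp (- b * h) \<le> exp (ln z)" "exp (ln z) \<le> exp (- a * h)" using that by simp_all
    then have "- b * h \<le> ln z" "ln z \<le> - a * h" by (simp_all only: exp_le_cancel_iff)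
    then show ?thesis using assms(1) by (simp add: field_simps)
  qed
  have "- ln y / h \<le> - ln x / h"
    using pos \<open>x \<le> y\<close> assms(1) by (simp add: divide_right_mono)
  then show "W_sub W h x \<le> W_sub W h y"
    unfolding W_sub_def using mono_onD[OF assms(2) ran[OF y pos(2)] ran[OF x pos(1)]] by simp
qed

section \<open>The critical point \<open>h_crit\<close> and the maximum of the ratio\<close>

text \<open>Strict convexity of \<open>exp\<close>, proved as a weighted mean inequality:
  \<open>ln z \<le> z - 1\<close> is used at \<open>1 / m\<close> and \<open>exp w / m\<close> with
  weights \<open>1 - r\<close> and \<open>r\<close>. Equality in both would force
  \<open>w = 0\<close>.\<close>

lemma exp_mult_less_convex:
  fixes r w :: real
  assumes "0 < r" "r < 1" "w \<noteq> 0"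
  shows "exp (r * w) < 1 - r + r * exp w"
proof -
  define m where "m = 1 - r + r * exp w"
  have m: "m > 0" using assms(1,2) by (simp add: m_def add_pos_pos)
  have l1: "- ln m \<le> 1 / m - 1" using ln_le_minus_one[of "1 / m"] m by (simp add: ln_div)
  have l2: "w - ln m \<le> exp w / m - 1" using ln_le_minus_one[of "exp w / m"] m by (simp add: ln_div)
  have "- ln m \<noteq> 1 / m - 1 \<or> w - ln m \<noteq> exp w / m - 1"
  proof (rule ccontr)
    assume "\<not> ?thesis"
    then have "1 / m = 1" "exp w / m = 1"
      using ln_eq_minus_one[of "1 / m"] ln_eq_minus_one[of "exp w / m"] m by (simp_all add: ln_div)
    then show False using \<open>w \<noteq> 0\<close> m by simp
  qed
  then have "(1 - r) * (- ln m) + r * (w - ln m) < (1 - r) * (1 / m - 1) + r * (exp w / m - 1)"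
    using l1 l2 assms(1,2)
    by (elim disjE) (intro add_less_le_mono add_le_less_mono mult_left_mono mult_strict_left_mono; simp)+
  also have "\<dots> = (1 - r + r * exp w) / m - 1"
    by (simp add: algebra_simps add_divide_distrib diff_divide_distrib)
  also have "\<dots> = 0" using m by (simp add: m_def)
  finally have "r * w < ln m" by (simp add: algebra_simps)
  then have "exp (r * w) < exp (ln m)" by (simp only: exp_less_cancel_iff)
  also have "\<dots> = m" using m by simp
  finally show ?thesis by (simp add: m_def)
qed

text \<open>The left-hand side is strictly decreasing in \<open>h\<close>, equals
  \<open>2 - 2 * r > 0\<close> at 0 and tends to \<open>- r < 0\<close>, so the definite description
  has exactly one candidate.\<close>

lemma h_crit:
  assumes "0 < r" "r < 1"
  shows "0 < h_crit r"
    and "(1 - r) * exp (- h_crit r) + exp (- (1 - r) * h_crit r) - r = 0"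
proof -
  define \<psi> where "\<psi> h = (1 - r) * exp (- h) + exp (- (1 - r) * h) - r" for h
  have dec: "\<psi> y < \<psi> x" if "x < y" for x y
    unfolding \<psi>_def using that assms by (intro diff_strict_right_mono add_strict_mono) auto
  have "(\<psi> \<longlongrightarrow> (1 - r) * 0 + 0 - r) at_top"
    unfolding \<psi>_def using assms
    by (intro tendsto_intros filterlim_compose[OF exp_at_bot] filterlim_uminus_at_bot_at_top
        filterlim_tendsto_neg_mult_at_bot[OF tendsto_const] filterlim_ident) auto
  then have "\<forall>\<^sub>F x in at_top. \<psi> x < 0" using assms(1) by (intro order_tendstoD(2)) auto
  then obtain N where N: "\<And>x. x \<ge> N \<Longrightarrow> \<psi> x < 0" unfolding eventually_at_top_linorder by blast
  have "\<psi> 0 > 0" using assms by (simp add: \<psi>_def)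
  have "\<exists>x. 0 \<le> x \<and> x \<le> max N 0 \<and> \<psi> x = 0"
    using \<open>\<psi> 0 > 0\<close> N[of "max N 0"]
    by (intro IVT2') (auto simp: \<psi>_def intro!: continuous_intros)
  then obtain x where "0 \<le> x" and x0: "\<psi> x = 0" by blast
  moreover have "x \<noteq> 0" using \<open>\<psi> 0 > 0\<close> x0 by auto
  ultimately have x: "0 < x" by simp
  have "\<exists>!h. 0 < h \<and> \<psi> h = 0"
  proof (rule ex1I[of _ x])
    fix z assume "0 < z \<and> \<psi> z = 0"
    then show "z = x" using x0 dec[of x z] dec[of z x] by (cases z x rule: linorder_cases) auto
  qed (use x x0 in auto)
  then have "0 < h_crit r \<and> \<psi> (h_crit r) = 0"
    unfolding h_crit_def \<psi>_def by (rule theI')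
  then show "0 < h_crit r"
    and "(1 - r) * exp (- h_crit r) + exp (- (1 - r) * h_crit r) - r = 0"
    by (simp_all add: \<psi>_def)
qed

lemma exp_ratio_le_h_crit:
  fixes r :: real
  assumes r: "0 < r" "r < 1"
  defines "K \<equiv> r * exp ((1 - r) * h_crit r)"
  shows "K < 2"
    and "(1 + exp (- r * t)) / (1 + exp (- t)) \<le> K"
    and "(1 + exp (- r * t)) / (1 + exp (- t)) = K \<longleftrightarrow> t = h_crit r"
proof -
  define \<eta> where "\<eta> = h_crit r"
  note \<eta> = h_crit[OF r, folded \<eta>_def]
  \<comment> \<open>Scaling the equation for \<open>\<eta>\<close> by
    \<open>exp ((1 - r) * \<eta>)\<close> gives a second form of \<open>K\<close>, from which
    \<open>K < 2\<close> can be read off.\<close>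
  have "exp ((1 - r) * \<eta>) * ((1 - r) * exp (- \<eta>) + exp (- (1 - r) * \<eta>) - r) = 0"
    using \<eta>(2) by simp
  also have "exp ((1 - r) * \<eta>) * ((1 - r) * exp (- \<eta>) + exp (- (1 - r) * \<eta>) - r)
      = (1 - r) * exp (- r * \<eta>) + 1 - K"
    by (simp add: K_def \<eta>_def[symmetric] algebra_simps flip: exp_add)
  finally have K: "K = 1 + (1 - r) * exp (- r * \<eta>)" by simp
  have "exp (- r * \<eta>) < 1" using r \<eta>(1) by simp
  then have "(1 - r) * exp (- r * \<eta>) < 1" using r
    by (intro order_le_less_trans[OF mult_right_mono[of "1 - r" 1]]) auto
  then show "K < 2" by (simp add: K)
  \<comment> \<open>The new form of \<open>K\<close> is used for the summand 1 and the defining form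
    for \<open>exp (- t)\<close>. Comparison with \<open>split\<close> then leaves only the
    convexity inequality at \<open>w = \<eta> - t\<close>.\<close>
  have val: "K * (1 + exp (- t)) = 1 + exp (- r * \<eta>) * (1 - r + r * exp (\<eta> - t))"
  proof -
    have "K * exp (- t) = r * (exp (- r * \<eta>) * exp (\<eta> - t))"
      by (simp add: K_def \<eta>_def[symmetric] algebra_simps flip: exp_add)
    then show ?thesis by (simp add: distrib_left) (simp add: K algebra_simps)
  qed
  have split: "exp (- r * t) = exp (- r * \<eta>) * exp (r * (\<eta> - t))"
    by (simp add: algebra_simps flip: exp_add)
  have less: "(1 + exp (- r * t)) / (1 + exp (- t)) < K" if "t \<noteq> \<eta>"
  proof -
    have "1 + exp (- r * t) < K * (1 + exp (- t))"
      unfolding val split using exp_mult_less_convex[OF r, of "\<eta> - t"] that by simp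
    then show ?thesis by (simp add: pos_divide_less_eq add_pos_pos)
  qed
  have eq: "(1 + exp (- r * t)) / (1 + exp (- t)) = K" if "t = \<eta>"
  proof -
    have "1 + exp (- r * t) = K * (1 + exp (- t))" unfolding val split using that by simp
    moreover have "1 + exp (- t) > 0" by (simp add: add_pos_pos)
    ultimately show ?thesis by simp
  qed
  show "(1 + exp (- r * t)) / (1 + exp (- t)) \<le> K" using less eq by (cases "t = \<eta>") auto
  show "(1 + exp (- r * t)) / (1 + exp (- t)) = K \<longleftrightarrow> t = h_crit r"
    using less eq by (auto simp: \<eta>_def)
qed

section \<open>The upper bound as a function of \<open>s\<close>\<close>

text \<open>The factor \<open>(x + 1)\<^sup>2\<close> cancels against two of the
  \<open>2 * M\<close> quotients, leaving \<open>(x - 1)\<^sup>2\<close>, which is strictly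
  increasing, times a power of the increasing function \<open>(x - 1) / (x + 1)\<close>.\<close>

lemma chebyshev_bound_strict_mono:
  fixes s t :: real
  assumes "1 < s" "s < t" "M \<ge> 1"
  shows "(s + 1)\<^sup>2 * ((s + 1) / (s - 1)) powi (- 2 * int M)
    < (t + 1)\<^sup>2 * ((t + 1) / (t - 1)) powi (- 2 * int M)"
proof -
  have eq: "(x + 1)\<^sup>2 * ((x + 1) / (x - 1)) powi (- 2 * int M)
      = (x - 1)\<^sup>2 * ((x - 1) / (x + 1)) ^ (2 * M - 2)" if "1 < x" for x :: real
  proof -
    have "- 2 * int M = - int (2 * M)" by simp
    then have "((x + 1) / (x - 1)) powi (- 2 * int M) = ((x - 1) / (x + 1)) ^ (2 * M)"
      by (simp only: power_int_minus power_int_of_nat power_inverse[symmetric]) simp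
    also have "2 * M = 2 + (2 * M - 2)" using assms(3) by simp
    also have "(x + 1)\<^sup>2 * ((x - 1) / (x + 1)) ^ (2 + (2 * M - 2))
        = (x - 1)\<^sup>2 * ((x - 1) / (x + 1)) ^ (2 * M - 2)"
      using that by (simp only: power_add power_divide) simp
    finally show ?thesis by simp
  qed
  have "(s - 1) / (s + 1) \<le> (t - 1) / (t + 1)" using assms(1,2) by (simp add: field_simps)
  then have "((s - 1) / (s + 1)) ^ (2 * M - 2) \<le> ((t - 1) / (t + 1)) ^ (2 * M - 2)"
    using assms(1) by (intro power_mono) auto
  moreover have "(s - 1)\<^sup>2 < (t - 1)\<^sup>2" using assms(1,2) by (intro power_strict_mono) auto
  moreover have "((s - 1) / (s + 1)) ^ (2 * M - 2) > 0" using assms(1) by simp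
  ultimately show ?thesis
    unfolding eq[OF assms(1)] eq[OF less_trans[OF assms(1,2)]]
    by (intro mult_less_le_imp_less) auto
qed

lemma chebyshev_bound_sqrt2:
  assumes "M \<ge> 1"
  shows "(sqrt 2 + 1)\<^sup>2 * ((sqrt 2 + 1) / (sqrt 2 - 1)) powi (- 2 * int M)
    = (sqrt 2 + 1) powi (- 4 * int M + 2)"
proof -
  define q where "q = sqrt 2 + 1"
  have q: "q > 0" by (simp add: q_def add_pos_pos)
  \<comment> \<open>As \<open>sqrt 2 - 1\<close> is the reciprocal of \<open>q\<close>, the quotient
    is \<open>q\<close> squared and everything is a power of \<open>q\<close>.\<close>
  have "(sqrt 2 - 1) * q = 1" by (simp add: q_def algebra_simps)
  then have "sqrt 2 - 1 = 1 / q" using q by (simp add: field_simps)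
  then have "(sqrt 2 + 1) / (sqrt 2 - 1) = q powi 2" by (simp add: q_def power2_eq_square)
  then have "(sqrt 2 + 1)\<^sup>2 * ((sqrt 2 + 1) / (sqrt 2 - 1)) powi (- 2 * int M)
      = q powi 2 * (q powi 2) powi (- 2 * int M)" by (simp add: q_def)
  also have "\<dots> = q powi (2 + 2 * (- 2 * int M))"
    unfolding power_int_mult[symmetric] by (rule power_int_add[symmetric]) (use q in simp)
  finally show ?thesis by (simp add: q_def add.commute)
qed

section \<open>Combination of the estimates\<close>

theorem theorem4p5:
  fixes a b h :: real and M :: nat
    and W f :: "real \<Rightarrow> real" and y d c :: "nat \<Rightarrow> real"
  assumes "0 < a" and "a < b" and "M \<ge> 1" and "0 < h"
    and "mono_on {a..b} W" and "bounded (W ` {a..b})"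
    and "\<exists>S \<subseteq> points_of_increase a b W. finite S \<and> card S = M + 1"
    and "\<And>x. 0 \<le> x \<Longrightarrow> f x = RS_integral a b (\<lambda>t. exp (- x * t)) W"
    and "gaussian_quadrature M (exp (- b * h)) (exp (- a * h)) (W_hat W b h) y d"
    and "\<And>\<nu>. \<nu> \<in> {1..M} \<Longrightarrow> c \<nu> = d (M - \<nu> + 1) / (1 + y (M - \<nu> + 1))"
  shows
    "let s = sqrt ((1 + exp (- a * h)) / (1 + exp (- b * h)));
         r = a / b;
         S = sqrt r * exp (1 / 2 * (1 - r) * h_crit r);
         E1 = (s + 1)\<^sup>2 * ((s + 1) / (s - 1)) powi (- 2 * int M) * f 0;
         E2 = (S + 1)\<^sup>2 * ((S + 1) / (S - 1)) powi (- 2 * int M) * f 0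
     in 0 < f 0 - (\<Sum>\<nu>=1..M. c \<nu>)
        \<and> f 0 - (\<Sum>\<nu>=1..M. c \<nu>) \<le> E1
        \<and> E1 \<le> E2
        \<and> E2 < (sqrt 2 + 1) powi (- 4 * int M + 2) * f 0
        \<and> (E1 = E2 \<longleftrightarrow> h = h_crit (a / b) / b)"
proof -
  define \<alpha> \<beta> where "\<alpha> = exp (- b * h)" and "\<beta> = exp (- a * h)"
  define V where "V = W_sub W h"
  define r where "r = a / b"
  define s where "s = sqrt ((1 + \<beta>) / (1 + \<alpha>))"
  define S where "S = sqrt r * exp (1 / 2 * (1 - r) * h_crit r)"
  define F where "F x = (x + 1)\<^sup>2 * ((x + 1) / (x - 1)) powi (- 2 * int M)" for x :: real
  have \<alpha>: "0 < \<alpha>" "\<alpha> < \<beta>" using assms(2,4) by (auto simp: \<alpha>_def \<beta>_def)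
  have r: "0 < r" "r < 1" using assms(1,2) by (auto simp: r_def)
  have V: "mono_on {\<alpha>..\<beta>} V"
    unfolding \<alpha>_def \<beta>_def V_def by (rule mono_on_W_sub[OF assms(4,5)])
  have gq: "gaussian_quadrature M \<alpha> \<beta> (\<lambda>x. RS_integral \<alpha> x (\<lambda>Y. 1 + Y) V) y d"
    using assms(9) unfolding W_hat_def[abs_def] \<alpha>_def \<beta>_def V_def by simp
  \<comment> \<open>At \<open>x = 0\<close> the integrand is the constant polynomial 1, so
    \<open>f 0\<close> is the total increase.\<close>
  have "f 0 = W b - W a"
  proof -
    have "has_RS_integral (poly 1) W a b (poly_RS W a b 1)"
      using assms(2,5) by (intro has_RS_integral_poly) auto
    then have "RS_integral a b (\<lambda>t. exp (- 0 * t)) W = poly_RS W a b 1"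
      by (intro RS_integral_eqI) (simp add: poly_1[abs_def])
    then show ?thesis using assms(8)[of 0] by (simp add: poly_RS_1)
  qed
  then have f0: "f 0 = V \<beta> - V \<alpha>" using assms(4) by (simp add: V_def W_sub_def \<alpha>_def \<beta>_def)
  \<comment> \<open>The weights \<open>c\<close> list the nodes in reverse order; the reversal is
    its own inverse on \<open>{1..M}\<close>.\<close>
  have c: "(\<Sum>\<nu>=1..M. c \<nu>) = (\<Sum>\<nu>=1..M. d \<nu> / (1 + y \<nu>))"
    by (rule sum.reindex_bij_witness[of _ "\<lambda>\<nu>. M - \<nu> + 1" "\<lambda>\<nu>. M - \<nu> + 1"])
      (auto simp: assms(10))
  obtain P where P: "P \<subseteq> points_of_increase a b W" "finite P" "card P = M + 1"
    using assms(7) by blast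
  define Q where "Q = (\<lambda>t. exp (- t * h)) ` P"
  have "inj_on (\<lambda>t. exp (- t * h)) P" using assms(4) by (auto simp: inj_on_def)
  then have "finite Q" "card Q = M + 1" using P by (auto simp: Q_def card_image)
  moreover have "Q \<subseteq> points_of_increase \<alpha> \<beta> V"
    unfolding Q_def \<alpha>_def \<beta>_def V_def
    by (intro image_subsetI points_of_increase_W_sub[OF assms(4)] subsetD[OF P(1)])
  ultimately have pos: "0 < f 0 - (\<Sum>\<nu>=1..M. c \<nu>)"
    unfolding f0 c using gauss_error_pos[OF _ _ V assms(3) gq, of Q] \<alpha> by simp
  \<comment> \<open>Together with \<open>pos\<close> this yields \<open>f 0 > 0\<close>, by which
    all bounds are multiplied below, including the strict one and the equality case.\<close>
  have "(\<Sum>\<nu>=1..M. c \<nu>) \<ge> 0"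
    unfolding c
  proof (rule sum_nonneg)
    fix \<nu> assume "\<nu> \<in> {1..M}"
    then have "0 < d \<nu>" "\<alpha> < y \<nu>" using gq by (simp_all add: gaussian_quadrature_def)
    then show "0 \<le> d \<nu> / (1 + y \<nu>)" using \<alpha>(1) by simp
  qed
  with pos have f0pos: "f 0 > 0" by simp

  have s1: "s > 1" using \<alpha> by (simp add: s_def)
  have "f 0 - (\<Sum>\<nu>=1..M. c \<nu>) \<le> 4 * ((s - 1) / (s + 1)) ^ (2 * M) * f 0"
    unfolding f0 c s_def using gauss_error_upper[OF _ \<alpha>(2) V assms(3) gq] \<alpha>(1) by simp
  also have "4 * ((s - 1) / (s + 1)) ^ (2 * M) \<le> F s"
  proof -
    have "- 2 * int M = - int (2 * M)" by simp
    then have "((s + 1) / (s - 1)) powi (- 2 * int M) = ((s - 1) / (s + 1)) ^ (2 * M)"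
      by (simp only: power_int_minus power_int_of_nat power_inverse[symmetric]) simp
    moreover have "2\<^sup>2 \<le> (s + 1)\<^sup>2" using s1 by (intro power_mono) auto
    ultimately show ?thesis unfolding F_def using s1 by (simp add: mult_right_mono)
  qed
  finally have upper: "f 0 - (\<Sum>\<nu>=1..M. c \<nu>) \<le> F s * f 0"
    using f0pos by (simp add: mult_right_mono)

  define K where "K = r * exp ((1 - r) * h_crit r)"
  have "exp ((1 - r) * h_crit r) = (exp (1 / 2 * (1 - r) * h_crit r))\<^sup>2"
    by (simp flip: exp_double)
  then have S: "S = sqrt K" by (simp add: S_def K_def real_sqrt_mult)
  \<comment> \<open>The ratio lemma is applied at \<open>t = b * h\<close>, where
    \<open>r * t = a * h\<close>.\<close>
  have sK: "s = sqrt ((1 + exp (- r * (b * h))) / (1 + exp (- (b * h))))"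
    using assms(1,2) by (simp add: s_def \<alpha>_def \<beta>_def r_def)
  have sS: "s \<le> S" "s = S \<longleftrightarrow> b * h = h_crit r"
    unfolding S sK K_def using exp_ratio_le_h_crit(2,3)[OF r, of "b * h"] by simp_all
  have S2: "S < sqrt 2" unfolding S K_def using exp_ratio_le_h_crit(1)[OF r] by simp
  have Fmono: "F x < F z" if "1 < x" "x < z" for x z
    unfolding F_def by (rule chebyshev_bound_strict_mono[OF that assms(3)])
  have "F S < F (sqrt 2)" using s1 sS(1) S2 by (intro Fmono) auto
  then have last: "F S < (sqrt 2 + 1) powi (- 4 * int M + 2)"
    unfolding F_def chebyshev_bound_sqrt2[OF assms(3)] .
  \<comment> \<open>Strict monotonicity of \<open>F\<close> carries the equality case over from
    \<open>s = S\<close>.\<close>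
  have Fle: "F s \<le> F S" and Feq: "F s = F S \<longleftrightarrow> s = S"
    using Fmono[OF s1, of S] sS(1) by (cases "s = S"; force)+
  have "b * h = h_crit r \<longleftrightarrow> h = h_crit r / b" using assms(1,2) by (auto simp: field_simps)
  with sS(2) Feq have eq: "F s * f 0 = F S * f 0 \<longleftrightarrow> h = h_crit r / b" using f0pos by simp
  have "0 < f 0 - (\<Sum>\<nu>=1..M. c \<nu>)
      \<and> f 0 - (\<Sum>\<nu>=1..M. c \<nu>) \<le> F s * f 0
      \<and> F s * f 0 \<le> F S * f 0
      \<and> F S * f 0 < (sqrt 2 + 1) powi (- 4 * int M + 2) * f 0
      \<and> (F s * f 0 = F S * f 0 \<longleftrightarrow> h = h_crit r / b)"
    using pos upper Fle last eq f0pos by (simp add: mult_right_mono)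
  then show ?thesis
    unfolding Let_def F_def s_def S_def r_def \<alpha>_def \<beta>_def .
qed

end
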